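(* For every $\alpha\in\mathbb{R}$, the distribution $BASLG_2(\alpha)$ has at most two modes; that is, its probability density function $z\mapsto f_Z(z;\alpha)$ on $\mathbb{R}$ has at most two local maximum points.
   Context: For $\alpha\in\mathbb{R}$, $BASLG_2(\alpha)$ (the Balakrishnan alpha skew logistic distribution with skewness parameter $\alpha$) is the continuous distribution on $\mathbb{R}$ with probability density function $$f_Z(z;\alpha)=\frac{[(1-\alpha z)^2+1]^2}{C_2(\alpha)}\,\frac{e^{-z}}{(1+e^{-z})^2},\quad z\in\mathbb{R},\qquad C_2(\alpha)=4+\frac{8\pi^2\alpha^2}{3}+\frac{7\pi^4\alpha^4}{15}.$$ A mode is a local maximum point of the density. *)

theory Defs
  imports "HOL-Analysis.Analysis"
begin

definition baslg2_norm :: "real \<Rightarrow> real" where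
  "baslg2_norm \<alpha> = 4 + 8 * pi\<^sup>2 * \<alpha>\<^sup>2 / 3 + 7 * pi ^ 4 * \<alpha> ^ 4 / 15"

definition baslg2_density :: "real \<Rightarrow> real \<Rightarrow> real" where
  "baslg2_density \<alpha> z =
     ((1 - \<alpha> * z)\<^sup>2 + 1)\<^sup>2 / baslg2_norm \<alpha> * (exp (- z) / (1 + exp (- z))\<^sup>2)"

text \<open>Local maximality is not required to be strict.\<close>

definition local_max_point :: "('a::topological_space \<Rightarrow> 'b::order) \<Rightarrow> 'a \<Rightarrow> bool" where
  "local_max_point f x \<longleftrightarrow> (\<forall>\<^sub>F y in nhds x. f y \<le> f x)"

definition baslg2_modes :: "real \<Rightarrow> real set" where
  "baslg2_modes \<alpha> = {z. local_max_point (baslg2_density \<alpha>) z}"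

end

theory Submission
  imports Defs
begin

text \<open>
  The density is differentiable, and its derivative is a positive function times
  \<open>k z = 4 * \<alpha> * (\<alpha> * z - 1) - ((\<alpha> * z - 1)\<^sup>2 + 1) * tanh (z / 2)\<close>,
  because the logistic density has logarithmic derivative \<open>- tanh (z / 2)\<close>
  (\<open>has_field_derivative_baslg2_density\<close>; \<open>k\<close> is
  \<open>baslg2_slope \<alpha>\<close>). Every mode is thus a zero of \<open>k\<close>. The reflection
  \<open>z \<mapsto> - z\<close> exchanges the parameters \<open>\<alpha>\<close> and
  \<open>- \<alpha>\<close>, and for \<open>\<alpha> = 0\<close> the only zero of \<open>k\<close> is 0, so
  let \<open>\<alpha> > 0\<close>.

  On the negative half-line \<open>k\<close> has at most one zero: with
  \<open>u = \<alpha> * z - 1 < -1\<close> a zero satisfies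
  \<open>4 * \<alpha> * u / (u\<^sup>2 + 1) = tanh (z / 2)\<close>, where the left side decreases in
  \<open>z\<close> and the right side increases (\<open>baslg2_slope_zero_unique_neg\<close>). On
  \<open>0 \<le> z \<le> 1 / \<alpha>\<close> the function \<open>k\<close> is negative. On
  \<open>z \<ge> 1 / \<alpha>\<close> it is strictly concave: in the second derivative the only term of the
  wrong sign is dominated because \<open>x < cosh x\<close>
  (\<open>baslg2_slope_deriv_strict_antimono\<close>). Between two zeros in that region \<open>k\<close> is
  therefore positive, the density increases from the left zero to the right one, and the left zero is no mode.
  This leaves at most one mode on each side of 0.
\<close>

section \<open>The sign of the derivative of the density\<close>

text \<open>
  The derivative of the density factors into a positive weight, irrelevant for its sign, and
  this function, which is polynomial except for one \<open>tanh\<close> and hence easy to differentiate again.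
\<close>
definition baslg2_slope :: "real \<Rightarrow> real \<Rightarrow> real" where
  "baslg2_slope \<alpha> z = 4 * \<alpha> * (\<alpha> * z - 1) - ((\<alpha> * z - 1)\<^sup>2 + 1) * tanh (z / 2)"

definition baslg2_weight :: "real \<Rightarrow> real \<Rightarrow> real" where
  "baslg2_weight \<alpha> z =
     ((1 - \<alpha> * z)\<^sup>2 + 1) / baslg2_norm \<alpha> * (exp (- z) / (1 + exp (- z))\<^sup>2)"

lemma baslg2_norm_pos: "baslg2_norm \<alpha> > 0"
proof -
  have "8 * pi\<^sup>2 * \<alpha>\<^sup>2 / 3 \<ge> 0" "7 * pi ^ 4 * \<alpha> ^ 4 / 15 \<ge> 0" by auto
  then show ?thesis unfolding baslg2_norm_def by linarith
qed

lemma baslg2_weight_pos: "baslg2_weight \<alpha> z > 0"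
proof -
  have "(1 - \<alpha> * z)\<^sup>2 + 1 > 0" by (smt (verit) zero_le_power2)
  moreover have "1 + exp (- z) > 0" by (smt (verit) exp_gt_zero)
  ultimately show ?thesis
    unfolding baslg2_weight_def using baslg2_norm_pos[of \<alpha>] by simp
qed

lemma has_field_derivative_logistic_density:
  fixes z :: real
  shows "((\<lambda>z. exp (- z) / (1 + exp (- z))\<^sup>2) has_field_derivative
           - tanh (z / 2) * (exp (- z) / (1 + exp (- z))\<^sup>2)) (at z)"
proof -
  define e where "e = exp (- z)"
  have e: "1 + e > 0" unfolding e_def by (smt (verit) exp_gt_zero)
  have tanh: "tanh (z / 2) = (1 - e) / (1 + e)"
    by (simp add: tanh_real_altdef e_def)
  have "((\<lambda>z. exp (- z)) has_field_derivative - e) (at z)"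
    and "((\<lambda>z. (1 + exp (- z))\<^sup>2) has_field_derivative 2 * (1 + e) * (- e)) (at z)"
    unfolding e_def by (auto intro!: derivative_eq_intros)
  from DERIV_divide[OF this]
  have "((\<lambda>z. exp (- z) / (1 + exp (- z))\<^sup>2) has_field_derivative
           (- e * (1 + e)\<^sup>2 - e * (2 * (1 + e) * (- e))) / ((1 + e)\<^sup>2 * (1 + e)\<^sup>2)) (at z)"
    using e by (simp add: e_def)
  moreover have "(- e * (1 + e)\<^sup>2 - e * (2 * (1 + e) * (- e))) / ((1 + e)\<^sup>2 * (1 + e)\<^sup>2)
      = - tanh (z / 2) * (e / (1 + e)\<^sup>2)"
  proof -
    have "- e * (1 + e)\<^sup>2 - e * (2 * (1 + e) * (- e)) = (1 + e) * (- (1 - e) * e)"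
      by (simp add: power2_eq_square algebra_simps)
    moreover have "(1 + e)\<^sup>2 * (1 + e)\<^sup>2 = (1 + e) * ((1 + e) * (1 + e)\<^sup>2)"
      by (simp add: power2_eq_square)
    ultimately show ?thesis
      using e by (simp add: tanh) (simp add: left_diff_distrib diff_divide_distrib)
  qed
  ultimately show ?thesis by (simp add: e_def)
qed

lemma has_field_derivative_baslg2_density:
  "(baslg2_density \<alpha> has_field_derivative baslg2_weight \<alpha> z * baslg2_slope \<alpha> z) (at z)"
proof -
  let ?N = "(1 - \<alpha> * z)\<^sup>2 + 1" and ?g = "\<lambda>z. exp (- z) / (1 + exp (- z))\<^sup>2"
  have poly: "((\<lambda>z. ((1 - \<alpha> * z)\<^sup>2 + 1)\<^sup>2 / baslg2_norm \<alpha>) has_field_derivative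
      ?N / baslg2_norm \<alpha> * (4 * \<alpha> * (\<alpha> * z - 1))) (at z)"
    using baslg2_norm_pos[of \<alpha>]
    by (auto intro!: derivative_eq_intros simp: field_simps)
  have "((\<lambda>z. ((1 - \<alpha> * z)\<^sup>2 + 1)\<^sup>2 / baslg2_norm \<alpha> * ?g z) has_field_derivative
      ?N / baslg2_norm \<alpha> * (4 * \<alpha> * (\<alpha> * z - 1)) * ?g z
      + (- tanh (z / 2) * ?g z) * (?N\<^sup>2 / baslg2_norm \<alpha>)) (at z)"
    by (rule DERIV_mult[OF poly has_field_derivative_logistic_density])
  moreover have "?N / baslg2_norm \<alpha> * (4 * \<alpha> * (\<alpha> * z - 1)) * ?g z
      + (- tanh (z / 2) * ?g z) * (?N\<^sup>2 / baslg2_norm \<alpha>)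
      = baslg2_weight \<alpha> z * baslg2_slope \<alpha> z"
  proof -
    have "(\<alpha> * z - 1)\<^sup>2 = (1 - \<alpha> * z)\<^sup>2" by (rule power2_commute)
    moreover have "n / c * k * g + (- t * g) * (n\<^sup>2 / c) = n / c * g * (k - n * t)"
      for n c k g t :: real
      by (simp add: power2_eq_square diff_divide_distrib algebra_simps)
    ultimately show ?thesis by (simp only: baslg2_weight_def baslg2_slope_def)
  qed
  moreover have "baslg2_density \<alpha> = (\<lambda>z. ((1 - \<alpha> * z)\<^sup>2 + 1)\<^sup>2 / baslg2_norm \<alpha> * ?g z)"
    by (rule ext) (simp add: baslg2_density_def)
  ultimately show ?thesis by simp
qed

lemma local_max_pointD:
  fixes f :: "real \<Rightarrow> real"
  assumes "local_max_point f x"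
  obtains d where "d > 0" "\<And>y. \<bar>x - y\<bar> < d \<Longrightarrow> f y \<le> f x"
  using assms unfolding local_max_point_def eventually_nhds_metric
  by (metis abs_minus_commute dist_real_def)

lemma baslg2_slope_mode:
  assumes "z \<in> baslg2_modes \<alpha>"
  shows "baslg2_slope \<alpha> z = 0"
proof -
  from assms have "local_max_point (baslg2_density \<alpha>) z" by (simp add: baslg2_modes_def)
  then obtain d where "d > 0" "\<And>y. \<bar>z - y\<bar> < d \<Longrightarrow> baslg2_density \<alpha> y \<le> baslg2_density \<alpha> z"
    by (rule local_max_pointD) blast
  then have "baslg2_weight \<alpha> z * baslg2_slope \<alpha> z = 0"
    using DERIV_local_max[OF has_field_derivative_baslg2_density] by blast
  then show ?thesis using baslg2_weight_pos[of \<alpha> z] by simp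
qed

lemma baslg2_slope_pos_right_not_mode:
  assumes "p < q" and pos: "\<And>z. p < z \<Longrightarrow> z < q \<Longrightarrow> baslg2_slope \<alpha> z > 0"
  shows "p \<notin> baslg2_modes \<alpha>"
proof
  assume "p \<in> baslg2_modes \<alpha>"
  then have "local_max_point (baslg2_density \<alpha>) p" by (simp add: baslg2_modes_def)
  then obtain d where d: "d > 0"
      "\<And>y. \<bar>p - y\<bar> < d \<Longrightarrow> baslg2_density \<alpha> y \<le> baslg2_density \<alpha> p"
    by (rule local_max_pointD) blast
  \<comment> \<open>A point right of \<open>p\<close> that lies both in the maximality neighbourhood and in \<open>(p, q)\<close>.\<close>
  define y where "y = p + min d (q - p) / 2"
  have y: "p < y" "y < q" "\<bar>p - y\<bar> < d"
    using d(1) \<open>p < q\<close> by (auto simp: y_def min_def field_simps)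
  obtain c where c: "p < c" "c < y"
      "baslg2_density \<alpha> y - baslg2_density \<alpha> p
         = (y - p) * (baslg2_weight \<alpha> c * baslg2_slope \<alpha> c)"
    using MVT2[OF y(1) has_field_derivative_baslg2_density] by blast
  have "baslg2_slope \<alpha> c > 0" using c y pos by simp
  then have "baslg2_density \<alpha> y - baslg2_density \<alpha> p > 0"
    unfolding c(3) using y baslg2_weight_pos[of \<alpha> c] by simp
  then show False using d(2)[OF y(3)] by simp
qed

section \<open>Negative modes\<close>

text \<open>
  For \<open>u < v < -1\<close> the identity
  \<open>u * (v\<^sup>2 + 1) - v * (u\<^sup>2 + 1) = (v - u) * (u * v - 1)\<close> shows that \<open>u / (u\<^sup>2 + 1)\<close> decreases.
  It can therefore agree with a positive multiple of the increasing \<open>tanh\<close> only once.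
\<close>
lemma baslg2_slope_zero_unique_neg:
  assumes "\<alpha> > 0" "p < q" "q < 0" "baslg2_slope \<alpha> p = 0"
  shows "baslg2_slope \<alpha> q \<noteq> 0"
proof
  assume "baslg2_slope \<alpha> q = 0"
  define u v where "u = \<alpha> * p - 1" and "v = \<alpha> * q - 1"
  have uv: "u < v" "v < -1"
    using assms by (auto simp: u_def v_def mult_pos_neg)
  have N: "u\<^sup>2 + 1 > 0" "v\<^sup>2 + 1 > 0" by (smt (verit) zero_le_power2)+
  have p: "4 * \<alpha> * u / (u\<^sup>2 + 1) = tanh (p / 2)"
    using assms(4) N by (simp add: baslg2_slope_def u_def field_simps)
  have q: "4 * \<alpha> * v / (v\<^sup>2 + 1) = tanh (q / 2)"
    using \<open>baslg2_slope \<alpha> q = 0\<close> N by (simp add: baslg2_slope_def v_def field_simps)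
  have "1 < u * v"
  proof -
    have "1 * 1 < (- u) * (- v)" using uv by (intro mult_strict_mono) auto
    then show ?thesis by simp
  qed
  then have "(v - u) * (u * v - 1) > 0" using uv by simp
  then have "v * (u\<^sup>2 + 1) < u * (v\<^sup>2 + 1)"
    by (simp add: algebra_simps power2_eq_square)
  then have "v / (v\<^sup>2 + 1) < u / (u\<^sup>2 + 1)" using N by (simp add: divide_simps)
  then have "4 * \<alpha> * (v / (v\<^sup>2 + 1)) < 4 * \<alpha> * (u / (u\<^sup>2 + 1))"
    using \<open>\<alpha> > 0\<close> by (intro mult_strict_left_mono) auto
  then have "tanh (q / 2) < tanh (p / 2)" using p q by simp
  then show False using \<open>p < q\<close> by simp
qed

section \<open>Positive modes\<close>

lemma baslg2_slope_neg_between: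
  assumes "\<alpha> > 0" "0 \<le> z" "\<alpha> * z \<le> 1"
  shows "baslg2_slope \<alpha> z < 0"
proof (cases "z = 0")
  case True
  then show ?thesis using assms by (simp add: baslg2_slope_def)
next
  case False
  have "4 * \<alpha> * (\<alpha> * z - 1) \<le> 0" using assms by (simp add: mult_nonneg_nonpos)
  moreover have "((\<alpha> * z - 1)\<^sup>2 + 1) * tanh (z / 2) > 0"
    using assms False by (intro mult_pos_pos) (auto intro: add_nonneg_pos)
  ultimately show ?thesis by (simp add: baslg2_slope_def)
qed

text \<open>
  From \<open>exp x = (exp (x / 2))\<^sup>2 \<ge> (1 + x / 2)\<^sup>2 = 2 * x + (1 - x / 2)\<^sup>2\<close>.
\<close>
lemma less_cosh_real:
  fixes x :: real
  assumes "x \<ge> 0"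
  shows "x < cosh x"
proof -
  have "(1 + x / 2)\<^sup>2 \<le> (exp (x / 2))\<^sup>2"
    using assms by (intro power_mono) (auto simp: exp_ge_add_one_self)
  also have "(exp (x / 2))\<^sup>2 = exp x" by (simp add: power2_eq_square flip: exp_add)
  finally have "(1 + x / 2)\<^sup>2 \<le> exp x" .
  moreover have "(1 + x / 2)\<^sup>2 = 2 * x + (1 - x / 2)\<^sup>2"
    by (simp add: power2_eq_square algebra_simps)
  ultimately have "2 * x < exp x + exp (- x)"
    by (smt (verit) zero_le_power2 exp_gt_zero)
  then show ?thesis by (simp add: cosh_def)
qed

lemma tanh_half_deriv_bound:
  fixes z :: real
  assumes "z \<ge> 0"
  shows "z\<^sup>2 * (1 - (tanh (z / 2))\<^sup>2) < 4"
proof -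
  have "(z / 2)\<^sup>2 < (cosh (z / 2))\<^sup>2"
    using assms less_cosh_real[of "z / 2"] by (intro power_strict_mono) auto
  then have "z\<^sup>2 / (cosh (z / 2))\<^sup>2 < 4" by (simp add: power_divide field_simps)
  moreover have "1 - (tanh (z / 2))\<^sup>2 = 1 / (cosh (z / 2))\<^sup>2"
    by (simp add: tanh_def power_divide cosh_square_eq field_simps add_nonneg_eq_0_iff)
  ultimately show ?thesis by simp
qed

definition baslg2_slope_deriv :: "real \<Rightarrow> real \<Rightarrow> real" where
  "baslg2_slope_deriv \<alpha> z = 4 * \<alpha>\<^sup>2 - 2 * \<alpha> * (\<alpha> * z - 1) * tanh (z / 2)
     - ((\<alpha> * z - 1)\<^sup>2 + 1) * ((1 - (tanh (z / 2))\<^sup>2) / 2)"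

lemma has_field_derivative_tanh_half:
  fixes z :: real
  shows "((\<lambda>z. tanh (z / 2)) has_field_derivative (1 - (tanh (z / 2))\<^sup>2) / 2) (at z)"
  by (auto intro!: derivative_eq_intros)

lemma has_field_derivative_quadratic_factor:
  fixes \<alpha> z :: real
  shows "((\<lambda>z. (\<alpha> * z - 1)\<^sup>2 + 1) has_field_derivative 2 * \<alpha> * (\<alpha> * z - 1)) (at z)"
  by (auto intro!: derivative_eq_intros)

lemma has_field_derivative_baslg2_slope:
  "(baslg2_slope \<alpha> has_field_derivative baslg2_slope_deriv \<alpha> z) (at z)"
proof -
  have "((\<lambda>z. 4 * \<alpha> * (\<alpha> * z - 1)) has_field_derivative 4 * \<alpha>\<^sup>2) (at z)"
    by (auto intro!: derivative_eq_intros simp: power2_eq_square)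
  from DERIV_diff[OF this DERIV_mult[OF has_field_derivative_quadratic_factor[of \<alpha> z]
      has_field_derivative_tanh_half[of z]]]
  show ?thesis
    unfolding baslg2_slope_def[abs_def] baslg2_slope_deriv_def
    by (rule DERIV_cong) (simp add: algebra_simps)
qed

lemma has_field_derivative_baslg2_slope_deriv:
  "(baslg2_slope_deriv \<alpha> has_field_derivative
      - (2 * \<alpha>\<^sup>2 * tanh (z / 2) + 2 * \<alpha> * (\<alpha> * z - 1) * (1 - (tanh (z / 2))\<^sup>2)
         - ((\<alpha> * z - 1)\<^sup>2 + 1) * tanh (z / 2) * (1 - (tanh (z / 2))\<^sup>2) / 2)) (at z)"
proof -
  let ?T = "tanh (z / 2)"
  have lin: "((\<lambda>z. 2 * \<alpha> * (\<alpha> * z - 1)) has_field_derivative 2 * \<alpha>\<^sup>2) (at z)"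
    by (auto intro!: derivative_eq_intros simp: power2_eq_square)
  have "((\<lambda>z. (1 - (tanh (z / 2))\<^sup>2) / 2) has_field_derivative - (?T * (1 - ?T\<^sup>2) / 2)) (at z)"
    by (auto intro!: derivative_eq_intros)
  from DERIV_diff[OF DERIV_diff[OF DERIV_const[of "4 * \<alpha>\<^sup>2"]
        DERIV_mult[OF lin has_field_derivative_tanh_half[of z]]]
      DERIV_mult[OF has_field_derivative_quadratic_factor[of \<alpha> z] this]]
  show ?thesis
    unfolding baslg2_slope_deriv_def[abs_def]
  proof (rule DERIV_cong)
    \<comment> \<open>Here \<open>d\<close> and \<open>e\<close> both stand for the derivative of \<open>tanh (z / 2)\<close>: one comes from each product
      rule, and keeping it opaque avoids expanding the powers of \<open>tanh\<close>.\<close>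
    have "0 - (2 * \<alpha>\<^sup>2 * t + d * (2 * a)) - (2 * a * e + - (t * d) * n)
        = - (2 * \<alpha>\<^sup>2 * t + 2 * a * (d + e) - n * t * d)"
      for t d e a n :: real
      by (simp add: algebra_simps)
    from this[of ?T "(1 - ?T\<^sup>2) / 2" "\<alpha> * (\<alpha> * z - 1)" "(1 - ?T\<^sup>2) / 2"
        "(\<alpha> * z - 1)\<^sup>2 + 1"]
    show "0 - (2 * \<alpha>\<^sup>2 * ?T + (1 - ?T\<^sup>2) / 2 * (2 * \<alpha> * (\<alpha> * z - 1)))
        - (2 * \<alpha> * (\<alpha> * z - 1) * ((1 - ?T\<^sup>2) / 2)
           + - (?T * (1 - ?T\<^sup>2) / 2) * ((\<alpha> * z - 1)\<^sup>2 + 1))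
        = - (2 * \<alpha>\<^sup>2 * ?T + 2 * \<alpha> * (\<alpha> * z - 1) * (1 - ?T\<^sup>2)
           - ((\<alpha> * z - 1)\<^sup>2 + 1) * ?T * (1 - ?T\<^sup>2) / 2)"
      by (simp add: mult.assoc)
  qed
qed

text \<open>
  Strict concavity of the slope for \<open>\<alpha> * z \<ge> 1\<close>. There \<open>(\<alpha> * z - 1)\<^sup>2 + 1 \<le> (\<alpha> * z)\<^sup>2\<close>, so the
  term with the wrong sign is smaller than \<open>2 * \<alpha>\<^sup>2 * tanh (z / 2)\<close>.
\<close>
lemma baslg2_slope_deriv_strict_antimono:
  assumes "\<alpha> > 0" "1 \<le> \<alpha> * p" "p < q"
  shows "baslg2_slope_deriv \<alpha> q < baslg2_slope_deriv \<alpha> p"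
proof (rule DERIV_neg_imp_decreasing[OF \<open>p < q\<close>])
  fix z assume "p \<le> z" "z \<le> q"
  then have az: "1 \<le> \<alpha> * z" using assms by (meson mult_left_mono less_imp_le order_trans)
  then have z: "z > 0" using \<open>\<alpha> > 0\<close> by (metis less_le_trans zero_less_one zero_less_mult_pos)
  define T where "T = tanh (z / 2)"
  have T: "T > 0" "T\<^sup>2 < 1"
    using z tanh_real_bounds[of "z / 2"] by (auto simp: T_def abs_square_less_1)
  have "((\<alpha> * z - 1)\<^sup>2 + 1) * (1 - T\<^sup>2) \<le> (\<alpha> * z)\<^sup>2 * (1 - T\<^sup>2)"
    using az T by (intro mult_right_mono) (auto simp: power2_eq_square algebra_simps)
  also have "\<dots> = \<alpha>\<^sup>2 * (z\<^sup>2 * (1 - T\<^sup>2))" by (simp add: power_mult_distrib)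
  also have "\<dots> < \<alpha>\<^sup>2 * 4"
    using tanh_half_deriv_bound[of z] z \<open>\<alpha> > 0\<close> by (simp add: T_def)
  finally have "((\<alpha> * z - 1)\<^sup>2 + 1) * (1 - T\<^sup>2) * T < \<alpha>\<^sup>2 * 4 * T"
    using T by simp
  then have "((\<alpha> * z - 1)\<^sup>2 + 1) * T * (1 - T\<^sup>2) / 2 < 2 * \<alpha>\<^sup>2 * T"
    by (simp add: mult_ac)
  moreover have "2 * \<alpha> * (\<alpha> * z - 1) * (1 - T\<^sup>2) \<ge> 0"
    using az T \<open>\<alpha> > 0\<close> by simp
  ultimately have "- (2 * \<alpha>\<^sup>2 * T + 2 * \<alpha> * (\<alpha> * z - 1) * (1 - T\<^sup>2)
         - ((\<alpha> * z - 1)\<^sup>2 + 1) * T * (1 - T\<^sup>2) / 2) < 0"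
    by linarith
  then show "\<exists>y. (baslg2_slope_deriv \<alpha> has_field_derivative y) (at z) \<and> y < 0"
    using has_field_derivative_baslg2_slope_deriv[of \<alpha> z] unfolding T_def by blast
qed

text \<open>
  If the slope were \<open>\<le> 0\<close> at \<open>z\<close>, the mean value theorem would give a point left of \<open>z\<close> where its
  derivative is \<open>\<le> 0\<close> and one right of \<open>z\<close> where it is \<open>\<ge> 0\<close>, against strict antitonicity.
\<close>
lemma baslg2_slope_pos_between_zeros:
  assumes "\<alpha> > 0" "1 \<le> \<alpha> * p" "p < z" "z < q"
    and "baslg2_slope \<alpha> p = 0" "baslg2_slope \<alpha> q = 0"
  shows "baslg2_slope \<alpha> z > 0"
proof (rule ccontr)
  assume "\<not> baslg2_slope \<alpha> z > 0"
  then have le: "baslg2_slope \<alpha> z \<le> 0" by simp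
  obtain c where c: "p < c" "c < z" "baslg2_slope \<alpha> z = (z - p) * baslg2_slope_deriv \<alpha> c"
    using MVT2[OF \<open>p < z\<close> has_field_derivative_baslg2_slope[of \<alpha>]] assms(5) by auto
  obtain d where d: "z < d" "d < q" "- baslg2_slope \<alpha> z = (q - z) * baslg2_slope_deriv \<alpha> d"
    using MVT2[OF \<open>z < q\<close> has_field_derivative_baslg2_slope[of \<alpha>]] assms(6) by auto
  have "1 \<le> \<alpha> * c" using assms(1,2) c(1) by (meson mult_left_mono less_imp_le order_trans)
  then have "baslg2_slope_deriv \<alpha> d < baslg2_slope_deriv \<alpha> c"
    using baslg2_slope_deriv_strict_antimono[OF \<open>\<alpha> > 0\<close>, of c d] c d by simp
  moreover have "baslg2_slope_deriv \<alpha> c \<le> 0"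
    using le c \<open>p < z\<close> by (simp add: mult_le_0_iff)
  moreover have "baslg2_slope_deriv \<alpha> d \<ge> 0"
  proof -
    have "0 \<le> (q - z) * baslg2_slope_deriv \<alpha> d" using le d(3) by linarith
    then show ?thesis using \<open>z < q\<close> by (simp add: zero_le_mult_iff)
  qed
  ultimately show False by simp
qed

section \<open>Counting the modes\<close>

lemma baslg2_density_reflect: "baslg2_density (- \<alpha>) (- z) = baslg2_density \<alpha> z"
proof -
  have "exp z / (1 + exp z)\<^sup>2 = exp (- z) / (1 + exp (- z))\<^sup>2"
  proof -
    have "exp z \<noteq> 0" "1 + exp z > 0" by (auto intro: add_pos_pos)
    then show ?thesis
      by (simp add: exp_minus divide_simps) (auto simp: power2_eq_square algebra_simps)
  qed
  then show ?thesis by (simp add: baslg2_density_def baslg2_norm_def)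
qed

lemma baslg2_modes_reflect: "baslg2_modes (- \<alpha>) = uminus ` baslg2_modes \<alpha>"
proof -
  have *: "- z \<in> baslg2_modes (- \<beta>)" if "z \<in> baslg2_modes \<beta>" for z \<beta>
  proof -
    from that have "local_max_point (baslg2_density \<beta>) z" by (simp add: baslg2_modes_def)
    then obtain d where d: "d > 0"
        "\<And>y. \<bar>z - y\<bar> < d \<Longrightarrow> baslg2_density \<beta> y \<le> baslg2_density \<beta> z"
      by (rule local_max_pointD) blast
    have "baslg2_density (- \<beta>) y \<le> baslg2_density (- \<beta>) (- z)" if "dist y (- z) < d" for y
    proof -
      have "baslg2_density (- \<beta>) y = baslg2_density \<beta> (- y)"
        using baslg2_density_reflect[of \<beta> "- y"] by simp
      moreover have "\<bar>z - (- y)\<bar> < d" using that by (simp add: dist_real_def add.commute)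
      ultimately show ?thesis using d(2)[of "- y"] by (simp add: baslg2_density_reflect)
    qed
    then show ?thesis
      using d(1) by (auto simp: baslg2_modes_def local_max_point_def eventually_nhds_metric)
  qed
  show ?thesis
  proof
    show "uminus ` baslg2_modes \<alpha> \<subseteq> baslg2_modes (- \<alpha>)" using * by auto
    show "baslg2_modes (- \<alpha>) \<subseteq> uminus ` baslg2_modes \<alpha>"
      using *[of _ "- \<alpha>"] by (force intro: image_eqI[where x = "- _"])
  qed
qed

lemma finite_card_le_1_if_unique:
  assumes "\<And>x y. x \<in> A \<Longrightarrow> y \<in> A \<Longrightarrow> x = y"
  shows "finite A \<and> card A \<le> 1"
proof (cases "A = {}")
  case False
  then obtain a where "a \<in> A" by blast
  then have "A = {a}" using assms by blast
  then show ?thesis by simp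
qed simp

lemma baslg2_modes_pos_parameter:
  assumes "\<alpha> > 0"
  shows "finite (baslg2_modes \<alpha>) \<and> card (baslg2_modes \<alpha>) \<le> 2"
proof -
  let ?M = "baslg2_modes \<alpha>"
  define A B where "A = ?M \<inter> {..<0}" and "B = ?M \<inter> {0..}"
  have "p = q" if "p \<in> A" "q \<in> A" for p q
    using that baslg2_slope_zero_unique_neg[OF assms] baslg2_slope_mode
    by (metis A_def Int_iff lessThan_iff linorder_neqE)
  then have A: "finite A \<and> card A \<le> 1" by (rule finite_card_le_1_if_unique)
  \<comment> \<open>Of two nonnegative modes, the left one fails to be a mode. The slope is negative up to
    \<open>1 / \<alpha>\<close>, so both lie in the region of strict concavity.\<close>
  have no_pair: False if "p \<in> B" "q \<in> B" "p < q" for p q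
  proof -
    have zeros: "baslg2_slope \<alpha> p = 0" "baslg2_slope \<alpha> q = 0"
      using that baslg2_slope_mode by (auto simp: B_def)
    then have "1 \<le> \<alpha> * p"
      using baslg2_slope_neg_between[OF assms, of p] that by (force simp: B_def)
    then have "baslg2_slope \<alpha> z > 0" if "p < z" "z < q" for z
      using baslg2_slope_pos_between_zeros[OF assms] that zeros by blast
    then have "p \<notin> ?M" using baslg2_slope_pos_right_not_mode[OF \<open>p < q\<close>] by blast
    then show False using that by (simp add: B_def)
  qed
  have B: "finite B \<and> card B \<le> 1"
    using no_pair by (intro finite_card_le_1_if_unique) (meson linorder_neqE)
  have "?M = A \<union> B" by (auto simp: A_def B_def)
  then show ?thesis using A B card_Un_le[of A B] by auto
qed

theorem theorem2:
  fixes \<alpha> :: real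
  shows "finite (baslg2_modes \<alpha>) \<and> card (baslg2_modes \<alpha>) \<le> 2"
proof (cases \<alpha> "0 :: real" rule: linorder_cases)
  case less
  have "baslg2_modes \<alpha> = uminus ` baslg2_modes (- \<alpha>)"
    using baslg2_modes_reflect[of "- \<alpha>"] by simp
  then show ?thesis
    using baslg2_modes_pos_parameter[of "- \<alpha>"] less by (simp add: card_image)
next
  case equal
  then have "baslg2_modes \<alpha> \<subseteq> {0}"
    using baslg2_slope_mode[of _ \<alpha>] by (auto simp: baslg2_slope_def)
  then show ?thesis
    using card_mono[of "{0}" "baslg2_modes \<alpha>"] by (auto intro: finite_subset)
next
  case greater
  then show ?thesis by (rule baslg2_modes_pos_parameter)
qed

end
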